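(* The following relations hold, where each inclusion holds for every nonempty $A\subseteq\mathbb R$ and each non-inclusion holds for some nonempty $A\subseteq\mathbb R$ (possibly a different $A$ for each non-inclusion): (a) $USC(A)\subseteq SC(A)$ for every nonempty $A\subseteq\mathbb R$, but there is a nonempty $A\subseteq\mathbb R$ with $SC(A)\nsubseteq USC(A)$; (b) $UC(A)\subseteq USC(A)$ for every nonempty $A\subseteq\mathbb R$, but there is a nonempty $A\subseteq\mathbb R$ with $USC(A)\nsubseteq UC(A)$; (c) there is a nonempty $A\subseteq\mathbb R$ with $USC(A)\nsubseteq C(A)$, and there is a nonempty $A\subseteq\mathbb R$ with $C(A)\nsubseteq USC(A)$.
   Context: Let $A$ be a nonempty subset of $\mathbb R$ and $f:A\to\mathbb R$. The function $f$ is symmetrically continuous at $a\in A$ if for every $\varepsilon>0$ there exists $\delta>0$ such that $|f(a+h)-f(a-h)|<\varepsilon$ for all $h\in\mathbb R$ such that $|h|<\delta$, $a+h\in A$ and $a-h\in A$; it is symmetrically continuous on $A$ if it is symmetrically continuous at every point of $A$. The function $f$ is uniformly symmetrically continuous on $A$ if for every $\varepsilon>0$ there exists $\delta>0$ such that $|f(a+h)-f(a-h)|<\varepsilon$ for all $h\in\mathbb R$ and $a\in A$ satisfying $|h|<\delta$, $a+h\in A$ and $a-h\in A$. Denote by $USC(A)$, $UC(A)$, $C(A)$ and $SC(A)$ the sets of all functions $f:A\to\mathbb R$ that are, respectively, uniformly symmetrically continuous, uniformly continuous, continuous, and symmetrically continuous on $A$. *)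

theory Defs
  imports "HOL-Analysis.Analysis" "HOL-Library.FuncSet"
begin

definition symmetrically_continuous_at :: "real set \<Rightarrow> (real \<Rightarrow> real) \<Rightarrow> real \<Rightarrow> bool" where
  "symmetrically_continuous_at A f a \<longleftrightarrow>
     (\<forall>\<epsilon>>0. \<exists>\<delta>>0. \<forall>h. \<bar>h\<bar> < \<delta> \<and> a + h \<in> A \<and> a - h \<in> A
        \<longrightarrow> \<bar>f (a + h) - f (a - h)\<bar> < \<epsilon>)"

definition symmetrically_continuous_on :: "real set \<Rightarrow> (real \<Rightarrow> real) \<Rightarrow> bool" where
  "symmetrically_continuous_on A f \<longleftrightarrow> (\<forall>a\<in>A. symmetrically_continuous_at A f a)"

definition uniformly_symmetrically_continuous_on :: "real set \<Rightarrow> (real \<Rightarrow> real) \<Rightarrow> bool" where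
  "uniformly_symmetrically_continuous_on A f \<longleftrightarrow>
     (\<forall>\<epsilon>>0. \<exists>\<delta>>0. \<forall>h. \<forall>a\<in>A. \<bar>h\<bar> < \<delta> \<and> a + h \<in> A \<and> a - h \<in> A
        \<longrightarrow> \<bar>f (a + h) - f (a - h)\<bar> < \<epsilon>)"

text \<open>
  A function from \<open>A\<close> to the reals is represented by its extensional version, that is, by the
  total function that takes the value \<open>undefined\<close> outside \<open>A\<close>. The elements of
  \<open>A \<rightarrow>\<^sub>E UNIV\<close> thus correspond one-to-one to the real-valued functions on \<open>A\<close>, and
  none of the conditions below depends on values outside \<open>A\<close>.
\<close>

definition USC :: "real set \<Rightarrow> (real \<Rightarrow> real) set" where
  "USC A = {f \<in> A \<rightarrow>\<^sub>E UNIV. uniformly_symmetrically_continuous_on A f}"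

definition UC :: "real set \<Rightarrow> (real \<Rightarrow> real) set" where
  "UC A = {f \<in> A \<rightarrow>\<^sub>E UNIV. uniformly_continuous_on A f}"

definition C :: "real set \<Rightarrow> (real \<Rightarrow> real) set" where
  "C A = {f \<in> A \<rightarrow>\<^sub>E UNIV. continuous_on A f}"

definition SC :: "real set \<Rightarrow> (real \<Rightarrow> real) set" where
  "SC A = {f \<in> A \<rightarrow>\<^sub>E UNIV. symmetrically_continuous_on A f}"

end

theory Submission
  imports Defs "HOL-Real_Asymp.Real_Asymp"
begin

text \<open>
  The squaring function on the whole line separates the continuous functions from the uniformly
  symmetrically continuous ones, since \<open>(a + h)\<^sup>2 - (a - h)\<^sup>2 = 4 * a * h\<close> is unbounded for small \<open>h\<close>.
  In the other direction, consider the indicator of \<open>0\<close> on \<open>0\<close> together with the reciprocals of the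
  odd naturals. It jumps at the accumulation point \<open>0\<close>, but \<open>0\<close> is never an endpoint of a
  nondegenerate symmetric triple in this set, because one odd reciprocal is never twice another.
\<close>

lemma uniformly_symmetrically_continuous_on_imp_symmetrically_continuous_on:
  "uniformly_symmetrically_continuous_on A f \<Longrightarrow> symmetrically_continuous_on A f"
  unfolding uniformly_symmetrically_continuous_on_def symmetrically_continuous_on_def
    symmetrically_continuous_at_def
  by meson

text \<open>The points \<open>a + h\<close> and \<open>a - h\<close> are
  \<open>2 * \<bar>h\<bar>\<close> apart, so half of the \<open>d\<close> given by uniform
  continuity works.\<close>

lemma uniformly_continuous_on_imp_uniformly_symmetrically_continuous_on:
  assumes "uniformly_continuous_on A f"
  shows "uniformly_symmetrically_continuous_on A f"
  unfolding uniformly_symmetrically_continuous_on_def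
proof (intro allI impI)
  fix \<epsilon> :: real
  assume "\<epsilon> > 0"
  then obtain d where d: "d > 0"
    and close: "\<And>x y. x \<in> A \<Longrightarrow> y \<in> A \<Longrightarrow> dist y x < d \<Longrightarrow> dist (f y) (f x) < \<epsilon>"
    using assms unfolding uniformly_continuous_on_def by meson
  have "\<bar>f (a + h) - f (a - h)\<bar> < \<epsilon>" if "\<bar>h\<bar> < d / 2" "a + h \<in> A" "a - h \<in> A" for a h
    using close[of "a - h" "a + h"] that by (simp add: dist_real_def)
  then show "\<exists>\<delta>>0. \<forall>h. \<forall>a\<in>A. \<bar>h\<bar> < \<delta> \<and> a + h \<in> A \<and> a - h \<in> A \<longrightarrow>
      \<bar>f (a + h) - f (a - h)\<bar> < \<epsilon>"
    using d by (intro exI[of _ "d / 2"]) auto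
qed

text \<open>Compare both endpoint values with \<open>f a\<close>, each within
  \<open>\<epsilon> / 2\<close>. This puts the squaring function into
  \<open>SC UNIV\<close>.\<close>

lemma continuous_on_imp_symmetrically_continuous_on:
  assumes "continuous_on A f"
  shows "symmetrically_continuous_on A f"
  unfolding symmetrically_continuous_on_def symmetrically_continuous_at_def
proof (intro ballI allI impI)
  fix a \<epsilon> :: real
  assume "a \<in> A" "\<epsilon> > 0"
  then obtain d where d: "d > 0"
    and close: "\<And>x. x \<in> A \<Longrightarrow> dist x a < d \<Longrightarrow> dist (f x) (f a) < \<epsilon> / 2"
    using assms unfolding continuous_on_iff by (meson half_gt_zero)
  have "\<bar>f (a + h) - f (a - h)\<bar> < \<epsilon>" if "\<bar>h\<bar> < d" "a + h \<in> A" "a - h \<in> A" for h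
    using close[of "a + h"] close[of "a - h"] that unfolding dist_real_def by (smt (verit) field_sum_of_halves)
  then show "\<exists>\<delta>>0. \<forall>h. \<bar>h\<bar> < \<delta> \<and> a + h \<in> A \<and> a - h \<in> A \<longrightarrow> \<bar>f (a + h) - f (a - h)\<bar> < \<epsilon>"
    using d by blast
qed

lemma square_not_uniformly_symmetrically_continuous_on:
  "\<not> uniformly_symmetrically_continuous_on UNIV (\<lambda>x. x\<^sup>2)"
proof
  assume "uniformly_symmetrically_continuous_on UNIV (\<lambda>x. x\<^sup>2)"
  then obtain \<delta> :: real where "\<delta> > 0"
    and bound: "\<And>h a. \<bar>h\<bar> < \<delta> \<Longrightarrow> \<bar>(a + h)\<^sup>2 - (a - h)\<^sup>2\<bar> < 1"
    unfolding uniformly_symmetrically_continuous_on_def by (metis UNIV_I zero_less_one)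
  \<comment> \<open>The midpoint grows as the step shrinks, keeping \<open>4 * a * h\<close> equal
    to 2 whatever \<open>\<delta>\<close> is.\<close>
  have "(1 / \<delta> + \<delta> / 2)\<^sup>2 - (1 / \<delta> - \<delta> / 2)\<^sup>2 = 2"
    using \<open>\<delta> > 0\<close> by (simp add: power2_eq_square field_simps)
  with bound[of "\<delta> / 2" "1 / \<delta>"] \<open>\<delta> > 0\<close> show False
    by simp
qed

text \<open>Even denominators are left out because 0, 1/(2n), 1/n would be arbitrarily short
  symmetric triples with an endpoint at 0.\<close>

definition odd_reciprocals :: "real set" where
  "odd_reciprocals = insert 0 (range (\<lambda>n::nat. 1 / real (2 * n + 1)))"

definition zero_indicator :: "real \<Rightarrow> real" where
  "zero_indicator = restrict (\<lambda>x. if x = 0 then 1 else 0) odd_reciprocals"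

text \<open>Parity: clearing denominators in 2/(2m+1) = 1/(2n+1) equates an even number with an odd
  one.\<close>

lemma odd_reciprocals_double:
  assumes "x \<in> odd_reciprocals" "2 * x \<in> odd_reciprocals"
  shows "x = 0"
proof (rule ccontr)
  assume "x \<noteq> 0"
  with assms obtain m n :: nat where "x = 1 / real (2 * m + 1)" "2 * x = 1 / real (2 * n + 1)"
    by (auto simp: odd_reciprocals_def)
  then have "2 * (1 / real (2 * m + 1)) = 1 / real (2 * n + 1)"
    by simp
  then have "real (2 * (2 * n + 1)) = real (2 * m + 1)"
    by (simp add: divide_simps del: of_nat_add)
  then have "2 * (2 * n + 1) = 2 * m + 1"
    unfolding of_nat_eq_iff .
  then show False
    by presburger
qed

lemma zero_indicator_uniformly_symmetrically_continuous_on: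
  "uniformly_symmetrically_continuous_on odd_reciprocals zero_indicator"
proof -
  have "zero_indicator (a + h) = zero_indicator (a - h)"
    if "a \<in> odd_reciprocals" "a + h \<in> odd_reciprocals" "a - h \<in> odd_reciprocals" for a h
  proof (cases "h = 0")
    case False
    \<comment> \<open>If one endpoint is 0, the other is \<open>2 * a\<close>; doubling then forces
      \<open>a = 0\<close>, hence \<open>h = 0\<close>.\<close>
    have "a + h \<noteq> 0"
    proof
      assume "a + h = 0"
      then have "a - h = 2 * a" by simp
      with that odd_reciprocals_double[of a] \<open>a + h = 0\<close> False show False by simp
    qed
    moreover have "a - h \<noteq> 0"
    proof
      assume "a - h = 0"
      then have "a + h = 2 * a" by simp
      with that odd_reciprocals_double[of a] \<open>a - h = 0\<close> False show False by simp
    qed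
    ultimately show ?thesis
      using that by (simp add: zero_indicator_def)
  qed simp
  \<comment> \<open>The endpoint values agree exactly, so any positive \<open>\<delta>\<close>
    serves.\<close>
  then show ?thesis
    unfolding uniformly_symmetrically_continuous_on_def by (auto intro: exI[of _ 1])
qed

lemma zero_indicator_not_continuous_on: "\<not> continuous_on odd_reciprocals zero_indicator"
proof
  assume cont: "continuous_on odd_reciprocals zero_indicator"
  \<comment> \<open>Along this sequence the values are constantly 0, while the value at the limit
    point is 1.\<close>
  have "(\<lambda>n::nat. 1 / real (2 * n + 1)) \<longlonglongrightarrow> 0"
    by real_asymp
  then have "(\<lambda>n::nat. zero_indicator (1 / real (2 * n + 1))) \<longlonglongrightarrow> zero_indicator 0"
    by (intro continuous_on_tendsto_compose[OF cont]) (auto simp: odd_reciprocals_def)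
  moreover have "zero_indicator (1 / real (2 * n + 1)) = 0" for n
    by (simp add: zero_indicator_def odd_reciprocals_def)
  moreover have "zero_indicator 0 = 1"
    by (simp add: zero_indicator_def odd_reciprocals_def)
  ultimately show False
    by (simp add: LIMSEQ_const_iff)
qed

theorem corollary2p6:
  shows "((\<forall>A::real set. A \<noteq> {} \<longrightarrow> USC A \<subseteq> SC A) \<and>
          (\<exists>A::real set. A \<noteq> {} \<and> \<not> SC A \<subseteq> USC A)) \<and>
         ((\<forall>A::real set. A \<noteq> {} \<longrightarrow> UC A \<subseteq> USC A) \<and>
          (\<exists>A::real set. A \<noteq> {} \<and> \<not> USC A \<subseteq> UC A)) \<and>
         ((\<exists>A::real set. A \<noteq> {} \<and> \<not> USC A \<subseteq> C A) \<and>
          (\<exists>A::real set. A \<noteq> {} \<and> \<not> C A \<subseteq> USC A))"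
proof -
  \<comment> \<open>Over \<open>UNIV\<close> extensionality is vacuous, so the squaring function
    needs no restriction.\<close>
  have square: "(\<lambda>x. x\<^sup>2) \<in> C UNIV" "(\<lambda>x. x\<^sup>2) \<in> SC UNIV" "(\<lambda>x. x\<^sup>2) \<notin> USC UNIV"
    using square_not_uniformly_symmetrically_continuous_on
    by (auto simp: C_def SC_def USC_def
        intro!: continuous_on_imp_symmetrically_continuous_on continuous_intros)
  have indicator: "zero_indicator \<in> USC odd_reciprocals" "zero_indicator \<notin> C odd_reciprocals"
    "zero_indicator \<notin> UC odd_reciprocals"
    using zero_indicator_uniformly_symmetrically_continuous_on zero_indicator_not_continuous_on
    by (auto simp: USC_def C_def UC_def zero_indicator_def
        dest: uniformly_continuous_imp_continuous)
  have "odd_reciprocals \<noteq> {}"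
    by (simp add: odd_reciprocals_def)
  moreover have "USC A \<subseteq> SC A" "UC A \<subseteq> USC A" for A
    by (auto simp: USC_def SC_def UC_def
        intro: uniformly_symmetrically_continuous_on_imp_symmetrically_continuous_on
          uniformly_continuous_on_imp_uniformly_symmetrically_continuous_on)
  ultimately show ?thesis
    using square indicator by blast
qed

end
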